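(* Let $Q$ be a fixed martingale measure. Let $a_1,\dots,a_d,K\in\mathbb{R}$, let $\phi:(\mathbb{R}^{[0,T]})^d\to[0,1]$ be measurable (a test), and let $$H=\Big(\sum_{i=1}^d a_iS^i_T-K\Big)\phi(\tilde S),\qquad \tilde S=\left(\left(\frac{S^i_t}{s^i_0\exp\left(\int_0^t\rho(u)\,du\right)}\right)_{t\le T}\right)_{i=1,\dots,d}.$$ Then the option price $p_Q(H)$ is given by $$p_Q(H)=\sum_{i=1}^d a_i s^i_0\,E_{Q_i}(\phi)-\exp\Big(-\int_0^T\rho(u)\,du\Big)K\,E_Q(\phi),$$ where on the right-hand side $$\phi=\phi\left(\left(\frac{dQ_{1|\mathcal{F}_t}}{dQ_{|\mathcal{F}_t}}\right)_{t\le T},\dots,\left(\frac{dQ_{d|\mathcal{F}_t}}{dQ_{|\mathcal{F}_t}}\right)_{t\le T}\right).$$ By linearity this extends to finite sums: if $H=\sum_{j=1}^m H_j$ with $H_j=\Big(\sum_{i=1}^d a_{i,j}S^i_T-K_j\Big)\phi_j(\tilde S)$, where $a_{i,j},K_j\in\mathbb{R}$ and each $\phi_j:(\mathbb{R}^{[0,T]})^d\to[0,1]$ is measurable (a test), then $$p_Q(H)=\sum_{j=1}^m\left(\sum_{i=1}^d a_{i,j} s^i_0\,E_{Q_i}(\phi_j)-\exp\Big(-\int_0^T\rho(u)\,du\Big)K_j\,E_Q(\phi_j)\right),$$ where on the right-hand side $$\phi_j=\phi_j\left(\left(\frac{dQ_{1|\mathcal{F}_t}}{dQ_{|\mathcal{F}_t}}\right)_{t\le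 T},\dots,\left(\frac{dQ_{d|\mathcal{F}_t}}{dQ_{|\mathcal{F}_t}}\right)_{t\le T}\right).$$
   Context: Fix $0<T<\infty$, the trading period $I=[0,T]$, and a probability space $(\Omega,\mathcal{F},P)$ with filtration $(\mathcal{F}_t)_{t\in I}$, $\mathcal{F}=\sigma(\mathcal{F}_t:t\in I)$ and $\mathcal{F}_0=\sigma(\{N\in\mathcal{F}:P(N)=0\text{ or }P(N)=1\})$. Let $(X^i_t)_{t\in I}$, $1\le i\le d$, be adapted (strictly) positive discounted price processes. The bond is $S^0_t=\exp\left(\int_0^t\rho(u)\,du\right)$ with an integrable deterministic interest rate $\rho:[0,T]\to\mathbb{R}$; the price processes are $S^i_t=S^0_tX^i_t$, with deterministic initial values $S^i_0=s^i_0>0$. A martingale measure is a probability measure $Q$ equivalent to $P$ such that each $(X^i_t)_{t\in I}$ is a $Q$-martingale. Given $Q$, the probability measures $Q_1,\dots,Q_d$ are defined by $\frac{dQ_i}{dQ}=\frac{X^i_T}{X^i_0}$; then $\frac{dQ_{i|\mathcal{F}_t}}{dQ_{|\mathcal{F}_t}}=\frac{X^i_t}{X^i_0}$ for all $t\in I$, and this version of the density process is the one used. The price of an option with payoff $H$ at time $T$ is $p_Q(H)=E_Q\big((S^0_T)^{-1}H\big)$. Measurability of $\phi$ is with respect to the product $\sigma$-field on $(\mathbb{R}^{[0,T]})^d$. *)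

theory Defs
  imports "HOL-Probability.Probability"
begin

text \<open>
  Assets are indexed by \<open>{1..d}\<close> and times by \<open>{0..T}\<close>.  A process is a curried function
  \<open>time \<Rightarrow> outcome \<Rightarrow> real\<close>; its values at times or asset indices outside these ranges are junk.
\<close>

definition cum_rate :: "(real \<Rightarrow> real) \<Rightarrow> real \<Rightarrow> real" where
  "cum_rate \<rho> t = (LINT u:{0..t}|lebesgue. \<rho> u)"

definition bond :: "(real \<Rightarrow> real) \<Rightarrow> real \<Rightarrow> real" where
  "bond \<rho> t = exp (cum_rate \<rho> t)"

definition price :: "(real \<Rightarrow> real) \<Rightarrow> (nat \<Rightarrow> real \<Rightarrow> 'a \<Rightarrow> real) \<Rightarrow> nat \<Rightarrow> real \<Rightarrow> 'a \<Rightarrow> real" where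
  "price \<rho> X i t \<omega> = bond \<rho> t * X i t \<omega>"

text \<open>
  The locale \<open>filtration\<close> of the library is indexed by a whole type, so the filtration over the
  interval \<open>{0..T}\<close> is spelled out.  As in the library, \<open>F t\<close> is a measure of which only the
  space and the \<open>\<sigma>\<close>-field matter.
\<close>

locale market = prob_space P
  for P :: "'a measure" and F :: "real \<Rightarrow> 'a measure" and T :: real
    and d :: nat and X :: "nat \<Rightarrow> real \<Rightarrow> 'a \<Rightarrow> real"
    and \<rho> :: "real \<Rightarrow> real" and s0 :: "nat \<Rightarrow> real" +
  assumes T_pos: "0 < T"
    and subalg: "\<And>t. t \<in> {0..T} \<Longrightarrow> subalgebra P (F t)"
    and sets_F_mono: "\<And>s t. 0 \<le> s \<Longrightarrow> s \<le> t \<Longrightarrow> t \<le> T \<Longrightarrow> sets (F s) \<subseteq> sets (F t)"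
    and sets_generated: "sets P = sigma_sets (space P) (\<Union>t\<in>{0..T}. sets (F t))"
    and sets_F0: "sets (F 0) = sigma_sets (space P) {N \<in> sets P. prob N = 0 \<or> prob N = 1}"
    and adapted: "\<And>i t. i \<in> {1..d} \<Longrightarrow> t \<in> {0..T} \<Longrightarrow> X i t \<in> borel_measurable (F t)"
    and X_pos: "\<And>i t \<omega>. i \<in> {1..d} \<Longrightarrow> t \<in> {0..T} \<Longrightarrow> \<omega> \<in> space P \<Longrightarrow> 0 < X i t \<omega>"
    and rate_integrable: "set_integrable lebesgue {0..T} \<rho>"
    and s0_pos: "\<And>i. i \<in> {1..d} \<Longrightarrow> 0 < s0 i"
    and initial_price: "\<And>i \<omega>. i \<in> {1..d} \<Longrightarrow> \<omega> \<in> space P \<Longrightarrow> price \<rho> X i 0 \<omega> = s0 i"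

definition martingale_on ::
  "'a measure \<Rightarrow> (real \<Rightarrow> 'a measure) \<Rightarrow> real \<Rightarrow> (real \<Rightarrow> 'a \<Rightarrow> real) \<Rightarrow> bool" where
  "martingale_on Q F T Y \<longleftrightarrow>
     (\<forall>t\<in>{0..T}. Y t \<in> borel_measurable (F t) \<and> integrable Q (Y t)) \<and>
     (\<forall>s t. 0 \<le> s \<and> s \<le> t \<and> t \<le> T \<longrightarrow> (AE \<omega> in Q. real_cond_exp Q (F s) (Y t) \<omega> = Y s \<omega>))"

definition martingale_measure ::
  "'a measure \<Rightarrow> (real \<Rightarrow> 'a measure) \<Rightarrow> real \<Rightarrow> nat \<Rightarrow> (nat \<Rightarrow> real \<Rightarrow> 'a \<Rightarrow> real) \<Rightarrow> 'a measure \<Rightarrow> bool"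
where
  "martingale_measure P F T d X Q \<longleftrightarrow>
     prob_space Q \<and> sets Q = sets P \<and> absolutely_continuous P Q \<and> absolutely_continuous Q P \<and>
     (\<forall>i\<in>{1..d}. martingale_on Q F T (X i))"

text \<open>The measure \<open>Q\<^sub>i\<close>, with the \<open>i\<close>-th asset as numeraire.\<close>

definition asset_measure ::
  "real \<Rightarrow> (nat \<Rightarrow> real \<Rightarrow> 'a \<Rightarrow> real) \<Rightarrow> 'a measure \<Rightarrow> nat \<Rightarrow> 'a measure" where
  "asset_measure T X Q i = density Q (\<lambda>\<omega>. ennreal (X i T \<omega> / X i 0 \<omega>))"

text \<open>
  The version of the density process of \<open>Q\<^sub>i\<close> with respect to \<open>Q\<close> along the filtration that is used
  throughout; \<open>density_process_is_density\<close> below shows that it is one.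
\<close>

definition density_process :: "(nat \<Rightarrow> real \<Rightarrow> 'a \<Rightarrow> real) \<Rightarrow> nat \<Rightarrow> real \<Rightarrow> 'a \<Rightarrow> real" where
  "density_process X i t \<omega> = X i t \<omega> / X i 0 \<omega>"

text \<open>
  The space \<open>(\<real>\<^bsup>[0,T]\<^esup>)\<^sup>d\<close> with its product \<open>\<sigma>\<close>-field.  Its points are extensional functions, so the
  families of paths below are restricted to \<open>{1..d}\<close> and \<open>{0..T}\<close>.
\<close>

definition path_space :: "nat \<Rightarrow> real \<Rightarrow> (nat \<Rightarrow> real \<Rightarrow> real) measure" where
  "path_space d T = (\<Pi>\<^sub>M i\<in>{1..d}. \<Pi>\<^sub>M t\<in>{0..T}. borel)"

definition test :: "nat \<Rightarrow> real \<Rightarrow> ((nat \<Rightarrow> real \<Rightarrow> real) \<Rightarrow> real) \<Rightarrow> bool" where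
  "test d T \<phi> \<longleftrightarrow>
     \<phi> \<in> borel_measurable (path_space d T) \<and> (\<forall>x\<in>space (path_space d T). \<phi> x \<in> {0..1})"

definition normalized_prices ::
  "nat \<Rightarrow> real \<Rightarrow> (nat \<Rightarrow> real \<Rightarrow> 'a \<Rightarrow> real) \<Rightarrow> (real \<Rightarrow> real) \<Rightarrow> (nat \<Rightarrow> real) \<Rightarrow> 'a \<Rightarrow> (nat \<Rightarrow> real \<Rightarrow> real)"
where
  "normalized_prices d T X \<rho> s0 \<omega> =
     (\<lambda>i\<in>{1..d}. \<lambda>t\<in>{0..T}. price \<rho> X i t \<omega> / (s0 i * exp (cum_rate \<rho> t)))"

definition density_paths ::
  "nat \<Rightarrow> real \<Rightarrow> (nat \<Rightarrow> real \<Rightarrow> 'a \<Rightarrow> real) \<Rightarrow> 'a \<Rightarrow> (nat \<Rightarrow> real \<Rightarrow> real)" where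
  "density_paths d T X \<omega> = (\<lambda>i\<in>{1..d}. \<lambda>t\<in>{0..T}. density_process X i t \<omega>)"

definition payoff ::
  "nat \<Rightarrow> real \<Rightarrow> (nat \<Rightarrow> real \<Rightarrow> 'a \<Rightarrow> real) \<Rightarrow> (real \<Rightarrow> real) \<Rightarrow> (nat \<Rightarrow> real) \<Rightarrow>
   (nat \<Rightarrow> real) \<Rightarrow> real \<Rightarrow> ((nat \<Rightarrow> real \<Rightarrow> real) \<Rightarrow> real) \<Rightarrow> 'a \<Rightarrow> real"
where
  "payoff d T X \<rho> s0 a K \<phi> \<omega> =
     ((\<Sum>i=1..d. a i * price \<rho> X i T \<omega>) - K) * \<phi> (normalized_prices d T X \<rho> s0 \<omega>)"

definition option_price :: "real \<Rightarrow> (real \<Rightarrow> real) \<Rightarrow> 'a measure \<Rightarrow> ('a \<Rightarrow> real) \<Rightarrow> real" where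
  "option_price T \<rho> Q H = (LINT \<omega>|Q. inverse (bond \<rho> T) * H \<omega>)"

lemma (in market) density_process_is_density:
  assumes Q: "martingale_measure P F T d X Q" and i: "i \<in> {1..d}" and t: "t \<in> {0..T}"
  shows "density (restr_to_subalg Q (F t)) (\<lambda>\<omega>. ennreal (density_process X i t \<omega>)) =
         restr_to_subalg (asset_measure T X Q i) (F t)"
proof -
  interpret Q: prob_space Q
    using Q by (simp add: martingale_measure_def)
  have sQ: "sets Q = sets P" and spQ: "space Q = space P"
    using Q by (auto simp: martingale_measure_def dest: sets_eq_imp_space_eq)
  have T: "T \<in> {0..T}" and z: "0 \<in> {0..T}" using T_pos by auto
  have mart: "martingale_on Q F T (X i)" using Q i by (simp add: martingale_measure_def)
  have sub: "subalgebra Q (F t)"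
    using subalg[OF t] sQ spQ by (simp add: subalgebra_def)
  have X0: "X i 0 \<omega> = s0 i" if "\<omega> \<in> space P" for \<omega>
  proof -
    have "cum_rate \<rho> 0 = 0"
      unfolding cum_rate_def set_lebesgue_integral_def
      by (rule integral_eq_zero_AE, rule AE_I[of _ _ "{0}"])
         (auto simp: indicator_def)
    then show ?thesis using initial_price[OF i that] by (simp add: price_def bond_def)
  qed
  have spF: "space (F t) = space P" using subalg[OF t] by (simp add: subalgebra_def)
  have intT: "integrable Q (X i T)" and intt: "integrable Q (X i t)"
    using mart T t by (auto simp: martingale_on_def)
  have ce: "AE \<omega> in Q. real_cond_exp Q (F t) (X i T) \<omega> = X i t \<omega>"
    using mart t by (simp add: martingale_on_def)
  interpret Qt: finite_measure_subalgebra Q "F t"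
    by unfold_locales (rule sub)
  note [measurable] = adapted[OF i t]
  have s0: "0 < s0 i" by (rule s0_pos[OF i])
  have Z: "density_process X i t \<in> borel_measurable (F t)"
  proof -
    have "(\<lambda>\<omega>. X i t \<omega> / s0 i) \<in> borel_measurable (F t)" by measurable
    then show ?thesis
      by (subst measurable_cong[where g="\<lambda>\<omega>. X i t \<omega> / s0 i"]) (simp_all add: X0 spF density_process_def)
  qed
  have ZQ: "density_process X i t \<in> borel_measurable Q"
    using measurable_from_subalg[OF sub Z] .
  have YQ: "(\<lambda>\<omega>. X i T \<omega> / X i 0 \<omega>) \<in> borel_measurable Q"
  proof -
    have "(\<lambda>\<omega>. X i T \<omega> / s0 i) \<in> borel_measurable Q" using intT by measurable
    then show ?thesis
      by (subst measurable_cong[where g="\<lambda>\<omega>. X i T \<omega> / s0 i"]) (simp_all add: X0 spQ)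
  qed
  have sub': "subalgebra (asset_measure T X Q i) (F t)"
    using sub by (simp add: subalgebra_def asset_measure_def)
  show ?thesis
  proof (rule measure_eqI)
    show "sets (density (restr_to_subalg Q (F t)) (\<lambda>\<omega>. ennreal (density_process X i t \<omega>))) =
          sets (restr_to_subalg (asset_measure T X Q i) (F t))"
      using sub sub' by (simp add: sets_restr_to_subalg)
  next
    fix A assume "A \<in> sets (density (restr_to_subalg Q (F t)) (\<lambda>\<omega>. ennreal (density_process X i t \<omega>)))"
    then have A: "A \<in> sets (F t)" using sub by (simp add: sets_restr_to_subalg)
    have AQ: "A \<in> sets Q" using A sub by (auto simp: subalgebra_def)
    have "(\<integral>\<omega>\<in>A. X i T \<omega> \<partial>Q) = (\<integral>\<omega>\<in>A. real_cond_exp Q (F t) (X i T) \<omega> \<partial>Q)"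
      by (rule Qt.real_cond_exp_intA[OF intT A])
    also have "\<dots> = (\<integral>\<omega>\<in>A. X i t \<omega> \<partial>Q)"
      unfolding set_lebesgue_integral_def
      by (rule integral_cong_AE) (use ce AQ intt in \<open>auto intro!: borel_measurable_times borel_measurable_indicator\<close>)
    finally have eq: "(\<integral>\<omega>\<in>A. X i T \<omega> \<partial>Q) = (\<integral>\<omega>\<in>A. X i t \<omega> \<partial>Q)" .
    have nn: "(\<integral>\<^sup>+\<omega>. ennreal (X i u \<omega> / X i 0 \<omega>) * indicator A \<omega> \<partial>Q) =
              ennreal ((\<integral>\<omega>\<in>A. X i u \<omega> \<partial>Q) / s0 i)" if u: "u \<in> {0..T}" and intu: "integrable Q (X i u)" for u
    proof -
      have "(\<integral>\<^sup>+\<omega>. ennreal (X i u \<omega> / X i 0 \<omega>) * indicator A \<omega> \<partial>Q) =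
            (\<integral>\<^sup>+\<omega>. ennreal (indicator A \<omega> * X i u \<omega> / s0 i) \<partial>Q)"
        by (rule nn_integral_cong) (auto simp: X0 spQ indicator_def)
      also have "\<dots> = ennreal (\<integral>\<omega>. indicator A \<omega> * X i u \<omega> / s0 i \<partial>Q)"
      proof (rule nn_integral_eq_integral)
        show "integrable Q (\<lambda>\<omega>. indicator A \<omega> * X i u \<omega> / s0 i)"
          using integrable_mult_indicator[OF AQ intu] by simp
        show "AE \<omega> in Q. 0 \<le> indicator A \<omega> * X i u \<omega> / s0 i"
          using s0 X_pos[OF i u] by (intro AE_I2) (auto simp: spQ indicator_def less_imp_le)
      qed
      finally show ?thesis by (simp add: set_lebesgue_integral_def)
    qed
    have "emeasure (density (restr_to_subalg Q (F t)) (\<lambda>\<omega>. ennreal (density_process X i t \<omega>))) A =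
          (\<integral>\<^sup>+\<omega>. ennreal (density_process X i t \<omega>) * indicator A \<omega> \<partial>restr_to_subalg Q (F t))"
      using Z A sub
      by (intro emeasure_density) (auto simp: sets_restr_to_subalg intro: measurable_in_subalg[OF sub])
    also have "\<dots> = (\<integral>\<^sup>+\<omega>. ennreal (density_process X i t \<omega>) * indicator A \<omega> \<partial>Q)"
      using Z A by (intro nn_integral_subalgebra2[OF sub] borel_measurable_times_ennreal borel_measurable_indicator) simp_all
    also have "\<dots> = (\<integral>\<^sup>+\<omega>. ennreal (X i T \<omega> / X i 0 \<omega>) * indicator A \<omega> \<partial>Q)"
      using nn[OF t intt] nn[OF T intT] eq by (simp add: density_process_def)
    also have "\<dots> = emeasure (asset_measure T X Q i) A"
      unfolding asset_measure_def using YQ AQ by (intro emeasure_density[symmetric]) auto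
    also have "\<dots> = emeasure (restr_to_subalg (asset_measure T X Q i) (F t)) A"
      by (rule emeasure_restr_to_subalg[OF sub' A, symmetric])
    finally show "emeasure (density (restr_to_subalg Q (F t)) (\<lambda>\<omega>. ennreal (density_process X i t \<omega>))) A =
      emeasure (restr_to_subalg (asset_measure T X Q i) (F t)) A" .
  qed
qed

end

theory Submission
  imports Defs
begin

text \<open>
  Two observations carry the proof. Since the initial prices are deterministic, dividing \<open>S\<^sup>i\<^sub>t\<close> by
  \<open>s\<^sup>i\<^sub>0\<close> and by the bond gives \<open>X\<^sup>i\<^sub>t / X\<^sup>i\<^sub>0\<close>, which is the density process of \<open>Q\<^sub>i\<close>; hence the
  normalized price vector fed into the test coincides with the vector of density processes pointwise, not just almost
  surely (\<open>normalized_prices_eq_density_paths\<close>). Secondly, the discounted terminal price of asset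
  \<open>i\<close> is \<open>X\<^sup>i\<^sub>T = s\<^sup>i\<^sub>0 dQ\<^sub>i/dQ\<close>, so its product with a bounded \<open>f\<close> has \<open>Q\<close>-expectation
  \<open>s\<^sup>i\<^sub>0 E\<^bsub>Q\<^sub>i\<^esub>(f)\<close>: the asset serves as numeraire (\<open>discounted_asset_expectation\<close>).

  The discounted payoff is a linear combination of such products and of the test itself. All of these
  are \<open>Q\<close>-integrable because \<open>X\<^sup>i\<^sub>T\<close> is and the test is bounded, so the formula follows
  from linearity of the expectation. Tracking the pair of integrability and value by
  \<open>has_bochner_integral\<close> makes the extension to finite sums immediate.
\<close>

context market
begin

lemma initial_value_eq:
  assumes i: "i \<in> {1..d}" and "\<omega> \<in> space P"
  shows "X i 0 \<omega> = s0 i"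
proof -
  \<comment> \<open>At time 0 the rate is integrated over the null set \<open>{0}\<close>, so the bond starts at 1.\<close>
  have "cum_rate \<rho> 0 = 0"
    unfolding cum_rate_def set_lebesgue_integral_def
    by (rule integral_eq_zero_AE, rule AE_I[of _ _ "{0}"]) (auto simp: indicator_def)
  then show ?thesis
    using initial_price[OF assms] by (simp add: price_def bond_def)
qed

lemma normalized_prices_eq_density_paths:
  assumes "\<omega> \<in> space P"
  shows "normalized_prices d T X \<rho> s0 \<omega> = density_paths d T X \<omega>"
  unfolding normalized_prices_def density_paths_def
  using assms
  by (intro restrict_ext)
     (simp add: price_def bond_def density_process_def initial_value_eq)

lemma measurable_density_paths:
  assumes Q: "martingale_measure P F T d X Q"
  shows "density_paths d T X \<in> Q \<rightarrow>\<^sub>M path_space d T"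
proof -
  have spQ: "space Q = space P"
    using Q by (auto simp: martingale_measure_def dest: sets_eq_imp_space_eq)
  have "density_process X i t \<in> borel_measurable Q" if i: "i \<in> {1..d}" and t: "t \<in> {0..T}" for i t
  proof -
    have "integrable Q (X i t)"
      using Q i t by (auto simp: martingale_measure_def martingale_on_def)
    note [measurable] = borel_measurable_integrable[OF this]
    have "(\<lambda>\<omega>. X i t \<omega> / s0 i) \<in> borel_measurable Q"
      by measurable
    then show ?thesis
      by (subst measurable_cong[where g = "\<lambda>\<omega>. X i t \<omega> / s0 i"])
         (simp_all add: density_process_def initial_value_eq[OF i] spQ)
  qed
  then show ?thesis
    unfolding path_space_def density_paths_def by (intro measurable_restrict) auto
qed

lemma test_density_paths_measurable:
  assumes "martingale_measure P F T d X Q" and "test d T \<phi>"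
  shows "(\<lambda>\<omega>. \<phi> (density_paths d T X \<omega>)) \<in> borel_measurable Q"
  using measurable_compose[OF measurable_density_paths[OF assms(1)]] assms(2)
  by (auto simp: test_def)

lemma test_density_paths_bounded:
  assumes "martingale_measure P F T d X Q" and "test d T \<phi>" and "\<omega> \<in> space Q"
  shows "\<bar>\<phi> (density_paths d T X \<omega>)\<bar> \<le> 1"
  using measurable_space[OF measurable_density_paths[OF assms(1)] assms(3)] assms(2)
  by (force simp: test_def)

text \<open>
  Change of numeraire: as \<open>X\<^sup>i\<^sub>T = s\<^sup>i\<^sub>0 dQ\<^sub>i/dQ\<close>, weighting by the discounted terminal price
  amounts to passing from \<open>Q\<close> to \<open>Q\<^sub>i\<close>. The bound on \<open>f\<close> makes the product integrable,
  since a martingale value is integrable but need not have higher moments.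
\<close>

lemma discounted_asset_expectation:
  fixes f :: "'a \<Rightarrow> real"
  assumes Q: "martingale_measure P F T d X Q" and i: "i \<in> {1..d}"
    and f: "f \<in> borel_measurable Q" and bounded: "\<And>\<omega>. \<omega> \<in> space Q \<Longrightarrow> \<bar>f \<omega>\<bar> \<le> c"
  shows "has_bochner_integral Q (\<lambda>\<omega>. X i T \<omega> * f \<omega>) (s0 i * (LINT \<omega>|asset_measure T X Q i. f \<omega>))"
proof -
  have spQ: "space Q = space P"
    using Q by (auto simp: martingale_measure_def dest: sets_eq_imp_space_eq)
  have T: "T \<in> {0..T}"
    using T_pos by simp
  have int: "integrable Q (X i T)"
    using Q i T by (auto simp: martingale_measure_def martingale_on_def)
  note [measurable] = borel_measurable_integrable[OF int] f
  have "integrable Q (\<lambda>\<omega>. X i T \<omega> * f \<omega>)"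
  proof (rule Bochner_Integration.integrable_bound)
    show "integrable Q (\<lambda>\<omega>. c * X i T \<omega>)"
      using int by simp
    show "AE \<omega> in Q. norm (X i T \<omega> * f \<omega>) \<le> norm (c * X i T \<omega>)"
      using bounded
      by (intro AE_I2) (fastforce simp: abs_mult mult.commute intro!: mult_right_mono)
  qed measurable
  moreover have "(LINT \<omega>|Q. X i T \<omega> * f \<omega>) = s0 i * (LINT \<omega>|asset_measure T X Q i. f \<omega>)"
  proof -
    have "asset_measure T X Q i = density Q (\<lambda>\<omega>. ennreal (X i T \<omega> / s0 i))"
      unfolding asset_measure_def
    proof (rule density_cong)
      show "(\<lambda>\<omega>. ennreal (X i T \<omega> / X i 0 \<omega>)) \<in> borel_measurable Q"
        by (subst measurable_cong[where g = "\<lambda>\<omega>. ennreal (X i T \<omega> / s0 i)"])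
           (simp_all add: initial_value_eq[OF i] spQ)
    qed (auto simp: initial_value_eq[OF i] spQ)
    moreover have "(LINT \<omega>|density Q (\<lambda>\<omega>. ennreal (X i T \<omega> / s0 i)). f \<omega>) =
        (LINT \<omega>|Q. (X i T \<omega> / s0 i) * f \<omega>)"
      using X_pos[OF i T] s0_pos[OF i]
      by (intro integral_real_density) (auto simp: spQ less_imp_le intro!: AE_I2)
    ultimately show ?thesis
      using s0_pos[OF i] by simp
  qed
  ultimately show ?thesis
    by (simp add: has_bochner_integral_iff)
qed

lemma discounted_payoff_expectation:
  assumes Q: "martingale_measure P F T d X Q" and test: "test d T \<phi>"
  shows "has_bochner_integral Q (\<lambda>\<omega>. inverse (bond \<rho> T) * payoff d T X \<rho> s0 a K \<phi> \<omega>)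
    ((\<Sum>i=1..d. a i * s0 i * (LINT \<omega>|asset_measure T X Q i. \<phi> (density_paths d T X \<omega>)))
      - exp (- cum_rate \<rho> T) * K * (LINT \<omega>|Q. \<phi> (density_paths d T X \<omega>)))"
proof -
  let ?f = "\<lambda>\<omega>. \<phi> (density_paths d T X \<omega>)"
  interpret Q: prob_space Q
    using Q by (simp add: martingale_measure_def)
  have spQ: "space Q = space P"
    using Q by (auto simp: martingale_measure_def dest: sets_eq_imp_space_eq)
  note f = test_density_paths_measurable[OF Q test] test_density_paths_bounded[OF Q test]
  have "integrable Q ?f"
    using f by (intro Q.integrable_const_bound[of _ 1]) (auto intro!: AE_I2)
  then have bond_part: "has_bochner_integral Q ?f (LINT \<omega>|Q. ?f \<omega>)"
    by (rule has_bochner_integral_integrable)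
  have "has_bochner_integral Q
      (\<lambda>\<omega>. (\<Sum>i=1..d. a i * (X i T \<omega> * ?f \<omega>)) - (exp (- cum_rate \<rho> T) * K) * ?f \<omega>)
      ((\<Sum>i=1..d. a i * (s0 i * (LINT \<omega>|asset_measure T X Q i. ?f \<omega>)))
        - (exp (- cum_rate \<rho> T) * K) * (LINT \<omega>|Q. ?f \<omega>))"
    by (intro has_bochner_integral_diff has_bochner_integral_sum has_bochner_integral_mult_right
        discounted_asset_expectation[OF Q _ f] bond_part)
  moreover have "(\<Sum>i=1..d. a i * (X i T \<omega> * ?f \<omega>)) - (exp (- cum_rate \<rho> T) * K) * ?f \<omega> =
      inverse (bond \<rho> T) * payoff d T X \<rho> s0 a K \<phi> \<omega>" if "\<omega> \<in> space Q" for \<omega>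
  proof -
    have "inverse (bond \<rho> T) * payoff d T X \<rho> s0 a K \<phi> \<omega> =
        (\<Sum>i=1..d. (inverse (bond \<rho> T) * bond \<rho> T) * (a i * (X i T \<omega> * ?f \<omega>)))
        - inverse (bond \<rho> T) * K * ?f \<omega>"
      using that normalized_prices_eq_density_paths
      by (simp add: payoff_def price_def spQ sum_distrib_left sum_distrib_right algebra_simps)
    then show ?thesis
      by (simp add: bond_def exp_minus)
  qed
  ultimately show ?thesis
    by (simp add: mult.assoc cong: has_bochner_integral_cong)
qed

end

theorem theorem3p1:
  fixes P Q :: "'a measure" and F :: "real \<Rightarrow> 'a measure" and T :: real and d :: nat
    and X :: "nat \<Rightarrow> real \<Rightarrow> 'a \<Rightarrow> real" and \<rho> :: "real \<Rightarrow> real" and s0 :: "nat \<Rightarrow> real"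
  assumes "market P F T d X \<rho> s0"
    and "martingale_measure P F T d X Q"
  shows
    "(\<forall>(a :: nat \<Rightarrow> real) (K :: real) \<phi>. test d T \<phi> \<longrightarrow>
        option_price T \<rho> Q (payoff d T X \<rho> s0 a K \<phi>) =
          (\<Sum>i=1..d. a i * s0 i * (LINT \<omega>|asset_measure T X Q i. \<phi> (density_paths d T X \<omega>)))
          - exp (- cum_rate \<rho> T) * K * (LINT \<omega>|Q. \<phi> (density_paths d T X \<omega>)))
     \<and>
     (\<forall>(m :: nat) (a :: nat \<Rightarrow> nat \<Rightarrow> real) (K :: nat \<Rightarrow> real) \<phi>. (\<forall>j\<in>{1..m}. test d T (\<phi> j)) \<longrightarrow>
        option_price T \<rho> Q (\<lambda>\<omega>. \<Sum>j=1..m. payoff d T X \<rho> s0 (\<lambda>i. a i j) (K j) (\<phi> j) \<omega>) =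
          (\<Sum>j=1..m.
             (\<Sum>i=1..d. a i j * s0 i * (LINT \<omega>|asset_measure T X Q i. \<phi> j (density_paths d T X \<omega>)))
             - exp (- cum_rate \<rho> T) * K j * (LINT \<omega>|Q. \<phi> j (density_paths d T X \<omega>))))"
proof -
  interpret market P F T d X \<rho> s0
    by (rule assms(1))
  note price = discounted_payoff_expectation[OF assms(2)]
  show ?thesis
  proof (intro conjI allI impI)
    fix a :: "nat \<Rightarrow> real" and K :: real and \<phi>
    assume "test d T \<phi>"
    then show "option_price T \<rho> Q (payoff d T X \<rho> s0 a K \<phi>) =
        (\<Sum>i=1..d. a i * s0 i * (LINT \<omega>|asset_measure T X Q i. \<phi> (density_paths d T X \<omega>)))
        - exp (- cum_rate \<rho> T) * K * (LINT \<omega>|Q. \<phi> (density_paths d T X \<omega>))"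
      unfolding option_price_def by (intro has_bochner_integral_integral_eq price)
  next
    fix m :: nat and a :: "nat \<Rightarrow> nat \<Rightarrow> real" and K :: "nat \<Rightarrow> real" and \<phi>
    assume "\<forall>j\<in>{1..m}. test d T (\<phi> j)"
    then show "option_price T \<rho> Q (\<lambda>\<omega>. \<Sum>j=1..m. payoff d T X \<rho> s0 (\<lambda>i. a i j) (K j) (\<phi> j) \<omega>) =
        (\<Sum>j=1..m.
          (\<Sum>i=1..d. a i j * s0 i * (LINT \<omega>|asset_measure T X Q i. \<phi> j (density_paths d T X \<omega>)))
          - exp (- cum_rate \<rho> T) * K j * (LINT \<omega>|Q. \<phi> j (density_paths d T X \<omega>)))"
      unfolding option_price_def sum_distrib_left
      by (intro has_bochner_integral_integral_eq has_bochner_integral_sum price) blast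
  qed
qed

end
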